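(* Let $G=(V,E)$ be a cycle-disjoint directed graph. For $\Lambda\in\mathbb R^E$ and a noise vector $\varepsilon$, let $S=(s_{ij})$ and $T=(t_{ijk})$ be the second- and third-order moments of $X=(I-\Lambda)^{-T}\varepsilon$, and put $$d_{uv}^{2\times 2}=\det\begin{pmatrix}s_{uu}&s_{uv}\\ t_{uuu}&t_{uuv}\end{pmatrix},\qquad d_{uv}^{3\times 3}=\det\begin{pmatrix}s_{uu}&s_{uv}&s_{vv}\\t_{uuu}&t_{uuv}&t_{uvv}\\t_{uuv}&t_{uvv}&t_{vvv}\end{pmatrix}.$$ Let $\mathcal C$ be the collection of all maximal subsets $C\subseteq V$ such that for all distinct $u,v\in C$, $d_{uv}^{3\times3}=0$ identically but $d_{uv}^{2\times2}$ is not identically zero. For $C,D\in\mathcal C$ define the residuals $X_{D.C}=X_D-R_{D,C}X_C$. Then $C$ is a root cycle if and only if the matrix $$\big(\mathbb E[X_c^2\,(X_{D.C})_d]\big)_{c\in C,\,d\in D}$$ is identically zero for all $D\in\mathcal C\setminus\{C\}$. Here "identically" means for any choice of $\Lambda\in\mathbb R^E$ and any distribution of the noise vector $\varepsilon$.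
   Context: A directed graph is cycle-disjoint if each of its nodes belongs to at most one directed cycle (2-cycles are allowed). $\mathbb R^E$ is the set of real $|V|\times|V|$ matrices $\Lambda=(\lambda_{ij})$ with $I-\Lambda$ invertible and $\lambda_{ij}=0$ whenever $i\to j\notin E$. A noise vector $\varepsilon=(\varepsilon_i)_{i\in V}$ is a centered random vector with independent components, positive variances and finite third moments. For $X=(I-\Lambda)^{-T}\varepsilon$, where $M^{-T}=(M^{-1})^T$, set $s_{ij}=\mathbb E[X_iX_j]$, $t_{ijk}=\mathbb E[X_iX_jX_k]$. For $A,B\subseteq V$, $R_{A,B}=S_{A,B}S_{B,B}^{-1}$ is the matrix of regression coefficients when regressing the variables $X_A$ on $X_B$. For $C\subseteq V$, $\mathrm{anc}(C)$ is the set of nodes having a directed path (of length at least $0$) to some node of $C$; $C$ is ancestral if $\mathrm{anc}(C)=C$. A root cycle is a directed cycle of $G$ that is ancestral (a cycle being identified with its vertex set).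
   Formalization: A single node with no other ancestors also counts as a (trivial) root cycle, though not for cycle-disjointness, and V is nonempty; otherwise the claim fails, e.g. for one node without edges. *)

theory Defs
  imports "HOL-Probability.Probability"
begin

text \<open>
  A directed graph is its edge relation on the nonempty finite vertex type \<open>'v\<close>.  Self-loops are
  not excluded; a self-loop counts as a directed cycle of length one.
\<close>

definition directed_cycle :: "('v \<times> 'v) set \<Rightarrow> 'v list \<Rightarrow> bool" where
  "directed_cycle E vs \<longleftrightarrow> vs \<noteq> [] \<and> distinct vs \<and>
     (\<forall>i < length vs. (vs ! i, vs ! (Suc i mod length vs)) \<in> E)"

definition cycles :: "('v \<times> 'v) set \<Rightarrow> 'v set set" where
  "cycles E = {set vs |vs. directed_cycle E vs}"

definition cycle_disjoint :: "('v \<times> 'v) set \<Rightarrow> bool" where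
  "cycle_disjoint E \<longleftrightarrow> (\<forall>v. \<forall>K \<in> cycles E. \<forall>L \<in> cycles E. v \<in> K \<longrightarrow> v \<in> L \<longrightarrow> K = L)"

definition anc :: "('v \<times> 'v) set \<Rightarrow> 'v set \<Rightarrow> 'v set" where
  "anc E C = {v. \<exists>c \<in> C. (v, c) \<in> E\<^sup>*}"

definition ancestral :: "('v \<times> 'v) set \<Rightarrow> 'v set \<Rightarrow> bool" where
  "ancestral E C \<longleftrightarrow> anc E C = C"

text \<open>
  Among root cycles, a single node counts as a (trivial) cycle, so that a source node is a root
  cycle.  Trivial cycles play no role in \<^const>\<open>cycle_disjoint\<close>.
\<close>

definition root_cycle :: "('v \<times> 'v) set \<Rightarrow> 'v set \<Rightarrow> bool" where
  "root_cycle E C \<longleftrightarrow> (C \<in> cycles E \<or> (\<exists>v. C = {v})) \<and> ancestral E C"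

definition coeff_matrices :: "('v::finite \<times> 'v) set \<Rightarrow> (real^'v^'v) set" where
  "coeff_matrices E =
     {\<Lambda>. invertible (mat 1 - \<Lambda>) \<and> (\<forall>i j. (i, j) \<notin> E \<longrightarrow> \<Lambda> $ i $ j = 0)}"

text \<open>
  The noise vector enters only through its distribution, so it is represented by its law,
  a Borel probability measure on \<open>real^'v\<close>, with the coordinates as components.
\<close>

definition noise_law :: "(real^'v::finite) measure \<Rightarrow> bool" where
  "noise_law N \<longleftrightarrow> prob_space N \<and> sets N = sets borel \<and>
     prob_space.indep_vars N (\<lambda>_. borel) (\<lambda>i e. e $ i) UNIV \<and>
     (\<forall>i. integrable N (\<lambda>e. \<bar>e $ i\<bar> ^ 3) \<and>
          prob_space.expectation N (\<lambda>e. e $ i) = 0 \<and>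
          prob_space.variance N (\<lambda>e. e $ i) > 0)"

definition sem :: "real^'v^'v \<Rightarrow> real^'v::finite \<Rightarrow> real^'v" where
  "sem \<Lambda> e = transpose (matrix_inv (mat 1 - \<Lambda>)) *v e"

definition mom2 :: "real^'v^'v \<Rightarrow> (real^'v::finite) measure \<Rightarrow> 'v \<Rightarrow> 'v \<Rightarrow> real" where
  "mom2 \<Lambda> N i j = (LINT e|N. sem \<Lambda> e $ i * sem \<Lambda> e $ j)"

definition mom3 :: "real^'v^'v \<Rightarrow> (real^'v::finite) measure \<Rightarrow> 'v \<Rightarrow> 'v \<Rightarrow> 'v \<Rightarrow> real" where
  "mom3 \<Lambda> N i j k = (LINT e|N. sem \<Lambda> e $ i * sem \<Lambda> e $ j * sem \<Lambda> e $ k)"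

definition d2 :: "real^'v^'v \<Rightarrow> (real^'v::finite) measure \<Rightarrow> 'v \<Rightarrow> 'v \<Rightarrow> real" where
  "d2 \<Lambda> N u v = (let s = mom2 \<Lambda> N; t = mom3 \<Lambda> N in
     det (vector [vector [s u u, s u v],
                  vector [t u u u, t u u v]] :: real^2^2))"

definition d3 :: "real^'v^'v \<Rightarrow> (real^'v::finite) measure \<Rightarrow> 'v \<Rightarrow> 'v \<Rightarrow> real" where
  "d3 \<Lambda> N u v = (let s = mom2 \<Lambda> N; t = mom3 \<Lambda> N in
     det (vector [vector [s u u, s u v, s v v],
                  vector [t u u u, t u u v, t u v v],
                  vector [t u u v, t u v v, t v v v]] :: real^3^3))"

definition identically ::
    "('v::finite \<times> 'v) set \<Rightarrow> (real^'v^'v \<Rightarrow> (real^'v) measure \<Rightarrow> bool) \<Rightarrow> bool" where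
  "identically E P \<longleftrightarrow> (\<forall>\<Lambda> \<in> coeff_matrices E. \<forall>N. noise_law N \<longrightarrow> P \<Lambda> N)"

definition admissible :: "('v::finite \<times> 'v) set \<Rightarrow> 'v set \<Rightarrow> bool" where
  "admissible E C \<longleftrightarrow> (\<forall>u \<in> C. \<forall>v \<in> C. u \<noteq> v \<longrightarrow>
     identically E (\<lambda>\<Lambda> N. d3 \<Lambda> N u v = 0) \<and> \<not> identically E (\<lambda>\<Lambda> N. d2 \<Lambda> N u v = 0))"

definition max_admissible :: "('v::finite \<times> 'v) set \<Rightarrow> 'v set set" where
  "max_admissible E = {C. admissible E C \<and> (\<forall>C'. admissible E C' \<and> C \<subseteq> C' \<longrightarrow> C' = C)}"

text \<open>
  The inverse of the \<open>B \<times> B\<close> submatrix of \<open>M\<close>: the definition of \<^const>\<open>matrix_inv\<close> with the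
  index type replaced by the index set \<open>B\<close>.  Entries outside \<open>B \<times> B\<close> are arbitrary.
\<close>

definition inv_on :: "'v set \<Rightarrow> ('v \<Rightarrow> 'v \<Rightarrow> real) \<Rightarrow> 'v \<Rightarrow> 'v \<Rightarrow> real" where
  "inv_on B M = (SOME Q. \<forall>i \<in> B. \<forall>j \<in> B.
     (\<Sum>k\<in>B. M i k * Q k j) = (if i = j then 1 else 0) \<and>
     (\<Sum>k\<in>B. Q i k * M k j) = (if i = j then 1 else 0))"

text \<open>
  The entry at row \<open>a\<close> and column \<open>b \<in> B\<close> of \<open>R\<^bsub>A,B\<^esub> = S\<^bsub>A,B\<^esub> S\<^bsub>B,B\<^esub>\<^sup>-\<^sup>1\<close>, for any \<open>A\<close> containing \<open>a\<close>;
  it does not depend on the rest of \<open>A\<close>.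
\<close>

definition reg_coeff ::
    "real^'v^'v \<Rightarrow> (real^'v::finite) measure \<Rightarrow> 'v set \<Rightarrow> 'v \<Rightarrow> 'v \<Rightarrow> real" where
  "reg_coeff \<Lambda> N B a b = (\<Sum>k\<in>B. mom2 \<Lambda> N a k * inv_on B (mom2 \<Lambda> N) k b)"

definition residual ::
    "real^'v^'v \<Rightarrow> (real^'v::finite) measure \<Rightarrow> 'v set \<Rightarrow> 'v \<Rightarrow> real^'v \<Rightarrow> real" where
  "residual \<Lambda> N C d e = sem \<Lambda> e $ d - (\<Sum>c\<in>C. reg_coeff \<Lambda> N C d c * sem \<Lambda> e $ c)"

end

theory Submission
  imports Defs
begin

text \<open>
  Write \<open>b = (I - \<Lambda>)\<^sup>-\<^sup>1\<close>, so that \<open>X\<^sub>j = \<Sum>i. b\<^sub>i\<^sub>j \<epsilon>\<^sub>i\<close>.  If \<open>v\<close> does not reach \<open>u\<close>, then some noise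
  component enters \<open>X\<^sub>v\<close> but not \<open>X\<^sub>u\<close>; if moreover \<open>d2\<close> is not identically zero, two components
  entering \<open>X\<^sub>u\<close> have non-proportional rows \<open>(b\<^sub>i\<^sub>u, b\<^sub>i\<^sub>v)\<close>.  Three pairwise non-proportional rows
  make \<open>d3\<close> nonzero for suitable noise.  Hence admissible sets lie in strongly connected components,
  which are cycles, and an ancestral \<open>C\<close> among the maximal ones is a root cycle.  It remains to
  characterise ancestrality.  If \<open>C\<close> is ancestral, regressing on \<open>X\<^sub>C\<close> removes exactly the noise of
  \<open>C\<close>, so residuals are independent of \<open>X\<^sub>C\<close>.  Otherwise there is an edge \<open>p \<rightarrow> c\<close> entering \<open>C\<close>;
  with this as the only edge of nonzero weight, \<open>X\<^sub>c\<close> is a collider of \<open>\<epsilon>\<^sub>p\<close> and \<open>\<epsilon>\<^sub>c\<close>, and the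
  residual of \<open>X\<^sub>p\<close> is \<open>(\<epsilon>\<^sub>p - \<epsilon>\<^sub>c) / 2\<close> for unit variances, which correlates with \<open>X\<^sub>c\<^sup>2\<close>.
\<close>

section \<open>Cycles and strongly connected components\<close>

lemma rtrancl_simple_path:
  assumes "(w, u) \<in> E\<^sup>*"
  shows "\<exists>vs. vs \<noteq> [] \<and> hd vs = w \<and> last vs = u \<and> distinct vs \<and> successively (\<lambda>x y. (x, y) \<in> E) vs"
  using assms
proof (induction rule: converse_rtrancl_induct)
  case base
  show ?case by (intro exI[of _ "[u]"]) simp
next
  case (step x y)
  then obtain vs where vs: "vs \<noteq> []" "hd vs = y" "last vs = u" "distinct vs"
    "successively (\<lambda>x y. (x, y) \<in> E) vs" by blast
  show ?case
  \<comment> \<open>If \<open>x\<close> already lies on the path, the suffix starting at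
    \<open>x\<close> is simple; otherwise \<open>x\<close> is prepended.\<close>
  proof (cases "x \<in> set vs")
    case True
    then obtain ys zs where "vs = ys @ x # zs" by (meson split_list)
    with vs show ?thesis by (intro exI[of _ "x # zs"]) (auto simp: successively_append_iff)
  next
    case False
    with vs step.hyps show ?thesis
      by (intro exI[of _ "x # vs"]) (auto simp: successively_Cons)
  qed
qed

text \<open>The edge closes a simple path from \<open>w\<close> back to \<open>u\<close>. For
  \<open>u = w\<close> that path is a single node and the cycle a self-loop.\<close>

lemma edge_on_cycle:
  assumes "(u, w) \<in> E" "(w, u) \<in> E\<^sup>*"
  obtains K where "K \<in> cycles E" "u \<in> K" "w \<in> K"
proof -
  obtain vs where vs: "vs \<noteq> []" "hd vs = w" "last vs = u" "distinct vs"
    "successively (\<lambda>x y. (x, y) \<in> E) vs" using rtrancl_simple_path[OF assms(2)] by blast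
  have "(vs ! i, vs ! (Suc i mod length vs)) \<in> E" if i: "i < length vs" for i
  proof (cases "Suc i < length vs")
    case True
    then show ?thesis using vs(5) by (simp add: successively_conv_nth)
  next
    case False
    then have "i = length vs - 1" "Suc i = length vs" using i by auto
    then show ?thesis using vs assms(1) by (simp add: hd_conv_nth last_conv_nth)
  qed
  then have "set vs \<in> cycles E" using vs by (auto simp: cycles_def directed_cycle_def)
  moreover have "u \<in> set vs" "w \<in> set vs" using vs by auto
  ultimately show ?thesis using that by blast
qed

text \<open>Each edge on the way from \<open>u\<close> to \<open>v\<close> can be closed to a cycle
  through \<open>u\<close>, and disjointness identifies that cycle with \<open>K\<close> one edge
  after another.\<close>

lemma cycle_contains_scc:
  assumes E: "cycle_disjoint E" and K: "K \<in> cycles E" "u \<in> K"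
    and uv: "(u, v) \<in> E\<^sup>*" and vu: "(v, u) \<in> E\<^sup>*"
  shows "v \<in> K"
  using uv vu
proof (induction rule: rtrancl_induct)
  case base
  show ?case by (rule K)
next
  case (step y z)
  have "y \<in> K"
    by (rule step.IH) (rule converse_rtrancl_into_rtrancl[OF step.hyps(2) step.prems])
  have "(z, y) \<in> E\<^sup>*" by (rule rtrancl_trans[OF step.prems step.hyps(1)])
  then obtain L where "L \<in> cycles E" "y \<in> L" "z \<in> L"
    by (rule edge_on_cycle[OF step.hyps(2)])
  then show ?case using E K \<open>y \<in> K\<close> unfolding cycle_disjoint_def by blast
qed

lemma cycle_strongly_connected:
  assumes "K \<in> cycles E" "u \<in> K" "v \<in> K"
  shows "(u, v) \<in> E\<^sup>*"
proof -
  obtain vs where vs: "K = set vs" "\<And>i. i < length vs \<Longrightarrow> (vs ! i, vs ! (Suc i mod length vs)) \<in> E"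
    using assms(1) by (auto simp: cycles_def directed_cycle_def)
  obtain i j where i: "i < length vs" "u = vs ! i" and j: "j < length vs" "v = vs ! j"
    using assms vs(1) by (metis in_set_conv_nth)
  have walk: "(vs ! i, vs ! ((i + k) mod length vs)) \<in> E\<^sup>*" for k
  proof (induction k)
    case (Suc k)
    have "(i + k) mod length vs < length vs" using i by (intro mod_less_divisor) auto
    from vs(2)[OF this] Suc show ?case
      by (simp add: mod_Suc_eq)
  qed (use i in simp)
  \<comment> \<open>Adding \<open>length vs\<close> keeps the natural subtraction from truncating
    when \<open>j < i\<close>.\<close>
  show ?thesis using walk[of "j + length vs - i"] i j by simp
qed

text \<open>Two distinct nodes of \<open>C\<close> yield a cycle \<open>K\<close> through one of
  them. Disjointness gives \<open>C \<subseteq> K\<close>, and ancestrality gives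
  \<open>K \<subseteq> C\<close>.\<close>

lemma root_cycleI:
  assumes E: "cycle_disjoint E" and "C \<noteq> {}" and anc: "ancestral E C"
    and conn: "\<And>u v. u \<in> C \<Longrightarrow> v \<in> C \<Longrightarrow> (u, v) \<in> E\<^sup>*"
  shows "root_cycle E C"
proof (cases "\<exists>v. C = {v}")
  case True
  then show ?thesis using anc by (simp add: root_cycle_def)
next
  case False
  then obtain u v where uv: "u \<in> C" "v \<in> C" "u \<noteq> v" using \<open>C \<noteq> {}\<close> by blast
  from conn[OF uv(1,2)] uv(3) obtain w where w: "(u, w) \<in> E" "(w, v) \<in> E\<^sup>*"
    by (blast elim: converse_rtranclE)
  then have "(w, u) \<in> E\<^sup>*" using conn[OF uv(2,1)] by (rule_tac rtrancl_trans)
  then obtain K where K: "K \<in> cycles E" "u \<in> K"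
    by (rule edge_on_cycle[OF w(1)])
  have "C \<subseteq> K"
  proof
    fix x assume "x \<in> C"
    then show "x \<in> K" using cycle_contains_scc[OF E K] conn uv(1) by blast
  qed
  moreover have "K \<subseteq> C"
  proof
    fix x assume "x \<in> K"
    then have "x \<in> anc E C"
      using cycle_strongly_connected[OF K(1) _ K(2)] uv(1) by (auto simp: anc_def)
    then show "x \<in> C" using anc by (simp add: ancestral_def)
  qed
  ultimately show ?thesis using K anc by (simp add: root_cycle_def)
qed

section \<open>Ancestral sets and extension to maximal admissible sets\<close>

lemma ancestral_edge: "ancestral E C \<Longrightarrow> (p, c) \<in> E \<Longrightarrow> c \<in> C \<Longrightarrow> p \<in> C"
  unfolding ancestral_def anc_def by blast

lemma ancestral_anc: "ancestral E (anc E C)"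
  unfolding ancestral_def anc_def by (auto intro: rtrancl_trans)

lemma ancestralI:
  assumes "\<And>p c. (p, c) \<in> E \<Longrightarrow> c \<in> C \<Longrightarrow> p \<in> C"
  shows "ancestral E C"
proof -
  have "v \<in> C" if "(v, c) \<in> E\<^sup>*" "c \<in> C" for v c
    using that by (induction rule: converse_rtrancl_induct) (auto intro: assms)
  then show ?thesis unfolding ancestral_def anc_def by blast
qed

lemma max_admissible_extend:
  fixes E :: "('v::finite \<times> 'v) set"
  assumes "admissible E A"
  obtains D where "A \<subseteq> D" "D \<in> max_admissible E"
proof -
  obtain D where "D \<in> {D. admissible E D}" "A \<subseteq> D" "\<forall>D'\<in>{D. admissible E D}. D \<subseteq> D' \<longrightarrow> D = D'"
    using finite_has_maximal2[of "{D. admissible E D}" A] assms by auto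
  then show ?thesis by (intro that[of D]) (auto simp: max_admissible_def)
qed

text \<open>Together with extension to maximal sets, this shows that every node lies in some member
  of \<open>max_admissible E\<close>.\<close>

lemma admissible_singleton: "admissible E {v}"
  by (simp add: admissible_def)

section \<open>Moments of the noise\<close>

abbreviation noise_var :: "(real^'v::finite) measure \<Rightarrow> 'v \<Rightarrow> real" where
  "noise_var N i \<equiv> (LINT e|N. (e $ i)\<^sup>2)"

abbreviation noise_skew :: "(real^'v::finite) measure \<Rightarrow> 'v \<Rightarrow> real" where
  "noise_skew N i \<equiv> (LINT e|N. (e $ i) ^ 3)"

lemma borel_measurable_vec_nth [measurable]: "(\<lambda>e::real^'v::finite. e $ i) \<in> borel_measurable borel"
  by (intro borel_measurable_continuous_onI continuous_intros)

lemma noise_power_integrable: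
  assumes "noise_law N" "m \<le> 3"
  shows "integrable N (\<lambda>e. (e $ i) ^ m)"
proof -
  interpret prob_space N using assms by (simp add: noise_law_def)
  have [measurable_cong]: "sets N = sets borel" using assms by (simp add: noise_law_def)
  have *: "integrable N (\<lambda>e. 1 + \<bar>e $ i\<bar> ^ 3)"
    using assms by (auto simp: noise_law_def)
  show ?thesis
  proof (rule Bochner_Integration.integrable_bound[OF *], measurable, intro AE_I2)
    fix e :: "real^'a"
    have "\<bar>e $ i\<bar> ^ m \<le> 1 + \<bar>e $ i\<bar> ^ 3"
    proof (cases "\<bar>e $ i\<bar> \<le> 1")
      case True
      then show ?thesis by (smt (verit) abs_ge_zero power_le_one zero_le_power)
    next
      case False
      then show ?thesis using power_increasing[OF assms(2), of "\<bar>e $ i\<bar>"] by linarith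
    qed
    then show "norm ((e $ i) ^ m) \<le> norm (1 + \<bar>e $ i\<bar> ^ 3)" by (simp add: power_abs)
  qed
qed

lemma noise_mean: "noise_law N \<Longrightarrow> (LINT e|N. e $ i) = 0"
  by (simp add: noise_law_def)

lemma noise_var_pos:
  assumes "noise_law N"
  shows "noise_var N i > 0"
proof -
  have "prob_space.variance N (\<lambda>e. e $ i) > 0" using assms unfolding noise_law_def by blast
  then show ?thesis by (simp add: noise_mean[OF assms])
qed

text \<open>Independence factorises the expectation; exponents up to 3 keep every factor
  integrable.\<close>

lemma noise_monomial:
  fixes N :: "(real^'v::finite) measure"
  assumes N: "noise_law N" and m: "\<And>l. m l \<le> 3"
  shows "has_bochner_integral N (\<lambda>e. \<Prod>l\<in>UNIV. (e $ l) ^ m l) (\<Prod>l\<in>UNIV. LINT e|N. (e $ l) ^ m l)"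
proof -
  interpret prob_space N using N by (simp add: noise_law_def)
  have "indep_vars (\<lambda>_. borel) (\<lambda>l e. e $ l) (UNIV :: 'v set)"
    using N by (simp add: noise_law_def)
  from indep_vars_compose2[OF this, of "\<lambda>l x. x ^ m l" "\<lambda>_. borel"]
  have ind: "indep_vars (\<lambda>_. borel) (\<lambda>l e. (e $ l) ^ m l) (UNIV :: 'v set)" by simp
  show ?thesis
    unfolding has_bochner_integral_iff
    using indep_vars_lebesgue_integral[OF _ ind] indep_vars_integrable[OF _ ind]
      noise_power_integrable[OF N m] by simp
qed

lemma prod_power_of_bool:
  fixes x :: "'v::finite \<Rightarrow> 'a::comm_monoid_mult"
  shows "(\<Prod>l\<in>UNIV. x l ^ of_bool (l = i)) = x i"
proof -
  have "(\<Prod>l\<in>UNIV. x l ^ of_bool (l = i)) = (\<Prod>l\<in>UNIV. if l = i then x l else 1)"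
    by (intro prod.cong) auto
  then show ?thesis by simp
qed

lemma noise_monomial2:
  assumes N: "noise_law N"
  shows "has_bochner_integral N (\<lambda>e. e $ i * e $ j) (if i = j then noise_var N i else 0)"
proof -
  interpret prob_space N using N by (simp add: noise_law_def)
  \<comment> \<open>\<open>m l\<close> counts how often \<open>l\<close> occurs among the indices,
    turning the product into a monomial over all coordinates.\<close>
  define m :: "'a \<Rightarrow> nat" where "m l = of_bool (l = i) + of_bool (l = j)" for l
  have "has_bochner_integral N (\<lambda>e. \<Prod>l\<in>UNIV. (e $ l) ^ m l) (\<Prod>l\<in>UNIV. LINT e|N. (e $ l) ^ m l)"
    by (rule noise_monomial[OF N]) (simp add: m_def)
  also have "(\<lambda>e::real^'a. \<Prod>l\<in>UNIV. (e $ l) ^ m l) = (\<lambda>e. e $ i * e $ j)"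
    by (simp add: m_def power_add prod.distrib prod_power_of_bool)
  also have "(\<Prod>l\<in>UNIV. LINT e|N. (e $ l) ^ m l) = (if i = j then noise_var N i else 0)"
  proof (cases "i = j")
    case True
    then have "(LINT e|N. (e $ l) ^ m l) = (if l = i then noise_var N i else 1)" for l
      by (auto simp: m_def prob_space numeral_2_eq_2)
    then show ?thesis using True by simp
  next
    case False
    then have "(LINT e|N. (e $ i) ^ m i) = 0"
      using noise_mean[OF N] by (simp add: m_def)
    then show ?thesis using False by (auto intro: prod_zero)
  qed
  finally show ?thesis .
qed

lemma noise_monomial3:
  assumes N: "noise_law N"
  shows "has_bochner_integral N (\<lambda>e. e $ i * e $ j * e $ k)
    (if i = j \<and> j = k then noise_skew N i else 0)"
proof -
  interpret prob_space N using N by (simp add: noise_law_def)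
  define m :: "'a \<Rightarrow> nat" where "m l = of_bool (l = i) + of_bool (l = j) + of_bool (l = k)" for l
  have "has_bochner_integral N (\<lambda>e. \<Prod>l\<in>UNIV. (e $ l) ^ m l) (\<Prod>l\<in>UNIV. LINT e|N. (e $ l) ^ m l)"
    by (rule noise_monomial[OF N]) (simp add: m_def)
  also have "(\<lambda>e::real^'a. \<Prod>l\<in>UNIV. (e $ l) ^ m l) = (\<lambda>e. e $ i * e $ j * e $ k)"
    by (simp add: m_def power_add prod.distrib prod_power_of_bool)
  also have "(\<Prod>l\<in>UNIV. LINT e|N. (e $ l) ^ m l) = (if i = j \<and> j = k then noise_skew N i else 0)"
  proof (cases "i = j \<and> j = k")
    case True
    then have "(LINT e|N. (e $ l) ^ m l) = (if l = i then noise_skew N i else 1)" for l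
      by (auto simp: m_def prob_space numeral_3_eq_3)
    then show ?thesis using True by simp
  next
    case False
    \<comment> \<open>Three indices that are not all equal include one occurring exactly once, and
      its centered factor annihilates the product.\<close>
    then have "\<exists>l. m l = 1" by (cases "i = j"; cases "i = k"; cases "j = k") (auto simp: m_def)
    then obtain l where "m l = 1" ..
    then have "(LINT e|N. (e $ l) ^ m l) = 0"
      using noise_mean[OF N] by simp
    then show ?thesis using False by (auto intro: prod_zero)
  qed
  finally show ?thesis .
qed

lemma noise_bilinear:
  assumes N: "noise_law N"
  shows "(LINT e|N. (\<Sum>i\<in>UNIV. a i * e $ i) * (\<Sum>i\<in>UNIV. b i * e $ i))
    = (\<Sum>i\<in>UNIV. noise_var N i * (a i * b i))"
proof -
  have "has_bochner_integral N (\<lambda>e. \<Sum>i\<in>UNIV. \<Sum>j\<in>UNIV. (a i * b j) * (e $ i * e $ j))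
    (\<Sum>i\<in>UNIV. \<Sum>j\<in>UNIV. (a i * b j) * (if i = j then noise_var N i else 0))"
    by (intro has_bochner_integral_sum has_bochner_integral_mult_right noise_monomial2[OF N])
  also have "(\<lambda>e. \<Sum>i\<in>UNIV. \<Sum>j\<in>UNIV. (a i * b j) * (e $ i * e $ j))
    = (\<lambda>e. (\<Sum>i\<in>UNIV. a i * e $ i) * (\<Sum>i\<in>UNIV. b i * e $ i))"
    by (simp add: sum_product mult_ac)
  finally show ?thesis
    by (simp add: has_bochner_integral_iff if_distrib mult_ac cong: if_cong)
qed

lemma noise_trilinear:
  assumes N: "noise_law N"
  shows "(LINT e|N. (\<Sum>i\<in>UNIV. a i * e $ i) * (\<Sum>i\<in>UNIV. b i * e $ i) * (\<Sum>i\<in>UNIV. c i * e $ i))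
    = (\<Sum>i\<in>UNIV. noise_skew N i * (a i * b i * c i))"
proof -
  have "has_bochner_integral N
      (\<lambda>e. \<Sum>i\<in>UNIV. \<Sum>j\<in>UNIV. \<Sum>k\<in>UNIV. (a i * b j * c k) * (e $ i * e $ j * e $ k))
      (\<Sum>i\<in>UNIV. \<Sum>j\<in>UNIV. \<Sum>k\<in>UNIV. (a i * b j * c k) *
        (if i = j \<and> j = k then noise_skew N i else 0))" (is "has_bochner_integral N ?f ?S")
    by (intro has_bochner_integral_sum has_bochner_integral_mult_right noise_monomial3[OF N])
  also have "?f = (\<lambda>e. (\<Sum>i\<in>UNIV. a i * e $ i) * (\<Sum>i\<in>UNIV. b i * e $ i) * (\<Sum>i\<in>UNIV. c i * e $ i))"
    by (simp only: mult.assoc sum_distrib_right) (simp only: sum_distrib_left mult_ac)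
  also have "?S = (\<Sum>i\<in>UNIV. \<Sum>j\<in>UNIV. if i = j then a i * b j * c j * noise_skew N i else 0)"
  proof (intro sum.cong refl)
    fix i j :: 'a
    have "(\<Sum>k\<in>UNIV. a i * b j * c k * (if i = j \<and> j = k then noise_skew N i else 0))
      = (\<Sum>k\<in>UNIV. if j = k then (if i = j then a i * b j * c j * noise_skew N i else 0) else 0)"
      by (intro sum.cong) auto
    then show "(\<Sum>k\<in>UNIV. a i * b j * c k * (if i = j \<and> j = k then noise_skew N i else 0))
      = (if i = j then a i * b j * c j * noise_skew N i else 0)" by simp
  qed
  finally show ?thesis
    by (simp add: has_bochner_integral_iff mult_ac)
qed

section \<open>Noise with prescribed variances and third moments\<close>

text \<open>The support points are the roots \<open>x > 0 > y\<close> of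
  \<open>z^2 = d * z + w\<close> with \<open>d = k / w\<close>, and \<open>q\<close> is the weight
  making the mean zero. Averaging this equation gives second moment \<open>w\<close>; multiplying it
  by \<open>z\<close> first gives third moment \<open>d * w = k\<close>.\<close>

lemma two_point_moments:
  fixes w k :: real
  assumes "w > 0"
  obtains q x y where "0 \<le> q" "q \<le> 1" "q * x + (1 - q) * y = 0"
    "q * x\<^sup>2 + (1 - q) * y\<^sup>2 = w" "q * x ^ 3 + (1 - q) * y ^ 3 = k"
proof -
  define d where "d = k / w"
  define r where "r = sqrt (d\<^sup>2 + 4 * w)"
  have r2: "r\<^sup>2 = d\<^sup>2 + 4 * w" using assms by (simp add: r_def)
  have "\<bar>d\<bar> < r" using assms by (simp add: r_def real_less_rsqrt)
  define x where "x = (d + r) / 2"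
  define y where "y = (d - r) / 2"
  define q where "q = - y / r"
  have r: "r > 0" and xy: "x - y = r" "x + y = d" "x > 0" "y < 0"
    using \<open>\<bar>d\<bar> < r\<close> by (auto simp: x_def y_def field_simps)
  have pr: "x * y = - w" using r2 by (simp add: x_def y_def field_simps power2_eq_square)
  have q: "q * r = - y" "(1 - q) * r = x" using r xy by (auto simp: q_def field_simps)
  have "(q * x + (1 - q) * y) * r = 0"
    using q by (metis (no_types, opaque_lifting) add.commute add.right_inverse distrib_right
        mult.assoc mult.commute mult_minus_left)
  then have m1: "q * x + (1 - q) * y = 0" using r by simp
  have m2: "q * x\<^sup>2 + (1 - q) * y\<^sup>2 = w" using m1 pr xy by algebra
  have m3: "q * x ^ 3 + (1 - q) * y ^ 3 = d * w" using m1 m2 pr xy by algebra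
  have "0 \<le> q" "q \<le> 1" using r xy by (auto simp: q_def field_simps)
  then show ?thesis using that m1 m2 m3 assms by (simp add: d_def)
qed

lemma noise_law_exists:
  fixes w k :: "'v::finite \<Rightarrow> real"
  assumes "\<And>i. w i > 0"
  obtains N where "noise_law N" "\<And>i. noise_var N i = w i" "\<And>i. noise_skew N i = k i"
proof -
  have "\<forall>i. \<exists>q x y. 0 \<le> q \<and> q \<le> 1 \<and> q * x + (1 - q) * y = 0 \<and>
    q * x\<^sup>2 + (1 - q) * y\<^sup>2 = w i \<and> q * x ^ 3 + (1 - q) * y ^ 3 = k i"
    by (metis assms two_point_moments)
  then obtain q x y where q: "\<And>i. 0 \<le> q i" "\<And>i. q i \<le> 1"
    and m: "\<And>i. q i * x i + (1 - q i) * y i = 0" "\<And>i. q i * (x i)\<^sup>2 + (1 - q i) * (y i)\<^sup>2 = w i"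
      "\<And>i. q i * x i ^ 3 + (1 - q i) * y i ^ 3 = k i"
    by metis
  \<comment> \<open>Independent coins choose between the two support points in each coordinate;
    \<open>N\<close> is the law of the resulting vector.\<close>
  define P where "P = Pi_pmf UNIV False (\<lambda>i. bernoulli_pmf (q i))"
  define z where "z i b = (if b then x i else y i)" for i b
  define Z :: "('v \<Rightarrow> bool) \<Rightarrow> real^'v" where "Z b = (\<chi> i. z i (b i))" for b
  define N where "N = distr (measure_pmf P) borel Z"
  have Zm: "Z \<in> measurable (measure_pmf P) borel" by simp
  have ex: "(LINT e|N. f (e $ i)) = q i * f (x i) + (1 - q i) * f (y i)"
    and int: "integrable N (\<lambda>e. f (e $ i))"
    if [measurable]: "f \<in> borel_measurable borel" for f :: "real \<Rightarrow> real" and i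
  proof -
    have [measurable]: "(\<lambda>e::real^'v. f (e $ i)) \<in> borel_measurable borel" by measurable
    have comp: "map_pmf (\<lambda>b. b i) P = bernoulli_pmf (q i)"
      by (simp add: P_def Pi_pmf_component)
    have "(LINT e|N. f (e $ i)) = (LINT b|measure_pmf P. f (z i (b i)))"
      unfolding N_def by (subst integral_distr) (auto simp: Z_def)
    also have "\<dots> = (LINT b|measure_pmf (map_pmf (\<lambda>b. b i) P). f (z i b))" by simp
    also have "\<dots> = q i * f (x i) + (1 - q i) * f (y i)"
      unfolding comp using q[of i] by (simp add: z_def)
    finally show "(LINT e|N. f (e $ i)) = q i * f (x i) + (1 - q i) * f (y i)" .
    have "integrable (measure_pmf (map_pmf (\<lambda>b. b i) P)) (\<lambda>b. f (z i b))"
      by (rule integrable_measure_pmf_finite) simp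
    then show "integrable N (\<lambda>e. f (e $ i))"
      unfolding N_def by (subst integrable_distr_eq) (auto simp: Z_def)
  qed
  have ps: "prob_space N" unfolding N_def by (rule measure_pmf.prob_space_distr) simp
  interpret N: prob_space N by (rule ps)
  have ind: "N.indep_vars (\<lambda>_. borel) (\<lambda>i e. e $ i) UNIV"
  proof (subst N.indep_vars_iff_distr_eq_PiM)
    have "prob_space.indep_vars (measure_pmf P) (\<lambda>_. count_space UNIV) (\<lambda>i b. b i) UNIV"
      unfolding P_def by (rule indep_vars_Pi_pmf) simp
    from prob_space.indep_vars_compose2[OF measure_pmf.prob_space_axioms this, of z "\<lambda>_. borel"]
    have "prob_space.indep_vars (measure_pmf P) (\<lambda>_. borel) (\<lambda>i b. z i (b i)) UNIV" by simp
    then have "distr P (\<Pi>\<^sub>M i\<in>UNIV. borel) (\<lambda>b. \<lambda>i\<in>UNIV. z i (b i)) =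
        (\<Pi>\<^sub>M i\<in>UNIV. distr P borel (\<lambda>b. z i (b i)))"
      by (subst (asm) prob_space.indep_vars_iff_distr_eq_PiM[OF measure_pmf.prob_space_axioms]) auto
    moreover have "(\<lambda>e::real^'v. \<lambda>i\<in>UNIV. e $ i) \<in> measurable borel (\<Pi>\<^sub>M i\<in>UNIV. borel)"
      by (intro measurable_restrict) simp
    moreover have "(\<lambda>i\<in>UNIV. Z b $ i) = (\<lambda>i\<in>UNIV. z i (b i))" for b
      by (simp add: Z_def restrict_def fun_eq_iff)
    moreover have "(\<lambda>b. Z b $ i) = (\<lambda>b. z i (b i))" for i
      by (simp add: Z_def)
    ultimately show "distr N (\<Pi>\<^sub>M i\<in>UNIV. borel) (\<lambda>e. \<lambda>i\<in>UNIV. e $ i) =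
        (\<Pi>\<^sub>M i\<in>UNIV. distr N borel (\<lambda>e. e $ i))"
      unfolding N_def by (simp add: distr_distr comp_def)
  qed (auto simp: N_def)
  have "noise_law N"
    unfolding noise_law_def using ps ind assms
      ex[of "\<lambda>x. x"] ex[of "\<lambda>x. x^2"] int[of "\<lambda>x. \<bar>x\<bar> ^ 3"] m
    by (simp add: N_def)
  moreover have "noise_var N i = w i" "noise_skew N i = k i" for i
    using ex[of "\<lambda>x. x^2"] ex[of "\<lambda>x. x^3"] m by simp_all
  ultimately show ?thesis using that by blast
qed

section \<open>Total effects and regression\<close>

abbreviation total_effect :: "real^'v::finite^'v \<Rightarrow> real^'v^'v" where
  "total_effect \<Lambda> \<equiv> matrix_inv (mat 1 - \<Lambda>)"

lemma matrix_inv_inverse: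
  fixes M :: "real^'n^'n"
  assumes "invertible M"
  shows "M ** matrix_inv M = mat 1" "matrix_inv M ** M = mat 1"
  using someI_ex[OF assms[unfolded invertible_def]] unfolding matrix_inv_def by auto

lemma matrix_inv_mult_cancel:
  fixes M :: "real^'n^'n"
  assumes "invertible M"
  shows "M *v (matrix_inv M *v x) = x" "matrix_inv M *v (M *v x) = x"
  using matrix_inv_inverse[OF assms] by (simp_all add: matrix_vector_mul_assoc)

lemma coeff_matrices_invertible: "\<Lambda> \<in> coeff_matrices E \<Longrightarrow> invertible (mat 1 - \<Lambda>)"
  by (simp add: coeff_matrices_def)

lemma sem_nth: "sem \<Lambda> e $ j = (\<Sum>i\<in>UNIV. total_effect \<Lambda> $ i $ j * e $ i)"
  by (simp add: sem_def matrix_vector_mult_def transpose_def)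

lemma mom2_eq:
  assumes "noise_law N"
  shows "mom2 \<Lambda> N u v =
    (\<Sum>i\<in>UNIV. noise_var N i * (total_effect \<Lambda> $ i $ u * total_effect \<Lambda> $ i $ v))"
  unfolding mom2_def sem_nth by (rule noise_bilinear[OF assms])

lemma mom3_eq:
  assumes "noise_law N"
  shows "mom3 \<Lambda> N u v w = (\<Sum>i\<in>UNIV. noise_skew N i *
    (total_effect \<Lambda> $ i $ u * total_effect \<Lambda> $ i $ v * total_effect \<Lambda> $ i $ w))"
  unfolding mom3_def sem_nth by (rule noise_trilinear[OF assms])

lemma mom2_commute: "mom2 \<Lambda> N u v = mom2 \<Lambda> N v u"
  by (simp add: mom2_def mult.commute)

text \<open>
  For ancestral \<open>U\<close> the matrix \<open>mat 1 - \<Lambda>\<close> maps the vectors supported in \<open>U\<close> into themselves;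
  being injective, it maps them onto themselves, and so does its inverse.
\<close>

lemma total_effect_support_iff:
  assumes L: "\<Lambda> \<in> coeff_matrices E" and U: "ancestral E U"
  shows "(\<forall>i. i \<notin> U \<longrightarrow> (total_effect \<Lambda> *v x) $ i = 0) \<longleftrightarrow> (\<forall>i. i \<notin> U \<longrightarrow> x $ i = 0)"
proof -
  define M where "M = mat 1 - \<Lambda>"
  have M: "invertible M" using coeff_matrices_invertible[OF L] by (simp add: M_def)
  define W where "W = {x::real^'a. \<forall>i. i \<notin> U \<longrightarrow> x $ i = 0}"
  have W: "subspace W" by (auto simp: W_def subspace_def)
  have sub: "(*v) M ` W \<subseteq> W"
  proof -
    have "(M *v x) $ i = 0" if x: "x \<in> W" and i: "i \<notin> U" for x i
    proof -
      have "\<Lambda> $ i $ l * x $ l = 0" for l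
      proof (cases "l \<in> U")
        case True
        then have "(i, l) \<notin> E" using ancestral_edge[OF U] i by blast
        then show ?thesis using L by (simp add: coeff_matrices_def)
      qed (use x in \<open>simp add: W_def\<close>)
      then have "(\<Lambda> *v x) $ i = 0"
        unfolding matrix_vector_mult_def vec_lambda_beta by (intro sum.neutral ballI)
      then show ?thesis using x i by (simp add: M_def W_def matrix_vector_mult_diff_rdistrib)
    qed
    then show ?thesis by (auto simp: W_def)
  qed
  have "inj ((*v) M)" using M by (metis injI matrix_inv_mult_cancel(2))
  then have "dim ((*v) M ` W) = dim W"
    by (intro dim_image_eq) (auto intro: inj_on_subset)
  then have onto: "(*v) M ` W = W"
    by (intro subspace_dim_equal sub W linear_subspace_image) auto
  have "matrix_inv M *v x \<in> W \<longleftrightarrow> x \<in> W"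
  proof
    assume "matrix_inv M *v x \<in> W"
    then have "M *v (matrix_inv M *v x) \<in> W" using sub by blast
    then show "x \<in> W" using M by (simp add: matrix_inv_mult_cancel)
  next
    assume "x \<in> W"
    then obtain y where "y \<in> W" "x = M *v y" using onto by blast
    then show "matrix_inv M *v x \<in> W" using M by (simp add: matrix_inv_mult_cancel)
  qed
  then show ?thesis by (simp add: W_def M_def)
qed

lemma total_effect_mult_axis: "(total_effect \<Lambda> *v axis j 1) $ i = total_effect \<Lambda> $ i $ j"
  by (simp add: matrix_vector_mul_component inner_axis)

lemma total_effect_ancestral_eq_0:
  assumes "\<Lambda> \<in> coeff_matrices E" "ancestral E U" "i \<notin> U" "j \<in> U"
  shows "total_effect \<Lambda> $ i $ j = 0"
  using total_effect_support_iff[OF assms(1,2), of "axis j 1"] assms(3,4)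
  unfolding total_effect_mult_axis by (auto simp: axis_def)

text \<open>Were column \<open>j\<close> supported in \<open>U\<close>, the unit vector at
  \<open>j\<close> would be too. So \<open>X_j\<close> always carries noise from outside
  \<open>U\<close>, even with cycles and special weights.\<close>

lemma total_effect_outside_ancestral:
  assumes "\<Lambda> \<in> coeff_matrices E" "ancestral E U" "j \<notin> U"
  obtains i where "i \<notin> U" "total_effect \<Lambda> $ i $ j \<noteq> 0"
  using total_effect_support_iff[OF assms(1,2), of "axis j 1"] assms(3)
  unfolding total_effect_mult_axis by (auto simp: axis_def split: if_splits)

section \<open>Submatrix inverses and regression coefficients\<close>

lemma inv_on_inverse:
  fixes M :: "'v::finite \<Rightarrow> 'v \<Rightarrow> real"
  assumes inj: "\<And>x. (\<And>i. i \<in> B \<Longrightarrow> (\<Sum>k\<in>B. M i k * x k) = 0) \<Longrightarrow> (\<And>k. k \<in> B \<Longrightarrow> x k = 0)"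
    and "i \<in> B" "j \<in> B"
  shows "(\<Sum>k\<in>B. M i k * inv_on B M k j) = (if i = j then 1 else 0)"
    "(\<Sum>k\<in>B. inv_on B M i k * M k j) = (if i = j then 1 else 0)"
proof -
  \<comment> \<open>Padding the block with an identity block outside \<open>B\<close> makes the
    theory of square matrices over the full index type applicable.\<close>
  define A :: "real^'v^'v" where
    "A = (\<chi> i k. if i \<in> B then (if k \<in> B then M i k else 0) else of_bool (i = k))"
  have restr: "(\<Sum>k\<in>UNIV. if k \<in> B then f k else 0) = sum f B" for f :: "'v \<Rightarrow> real"
    by (simp add: sum.If_cases)
  have "A *v x = 0 \<longrightarrow> x = 0" for x
  proof
    assume A0: "A *v x = 0"
    have row: "(\<Sum>k\<in>UNIV. A $ i $ k * x $ k) = 0" for i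
      using A0 by (simp add: matrix_vector_mult_def vec_eq_iff)
    have out: "x $ i = 0" if "i \<notin> B" for i
      using row[of i] that by (simp add: A_def)
    have "(\<Sum>k\<in>B. M i k * x $ k) = 0" if "i \<in> B" for i
      using row[of i] that by (simp add: A_def if_distrib[of "\<lambda>y. y * _"] restr cong: if_cong)
    then have "x $ i = 0" for i using inj[of "\<lambda>k. x $ k"] out by blast
    then show "x = 0" by (simp add: vec_eq_iff)
  qed
  then obtain Q where "Q ** A = mat 1" using matrix_left_invertible_ker by blast
  then have Q: "Q ** A = mat 1" "A ** Q = mat 1" using matrix_left_right_inverse by blast+
  have "\<exists>Q. \<forall>i\<in>B. \<forall>j\<in>B. (\<Sum>k\<in>B. M i k * Q k j) = (if i = j then 1 else 0) \<and>
     (\<Sum>k\<in>B. Q i k * M k j) = (if i = j then 1 else 0)"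
  proof (intro exI[of _ "\<lambda>i j. Q $ i $ j"] ballI conjI)
    fix i j assume ij: "i \<in> B" "j \<in> B"
    have "(A ** Q) $ i $ j = (if i = j then 1 else 0)" "(Q ** A) $ i $ j = (if i = j then 1 else 0)"
      unfolding Q by (simp_all add: mat_def)
    moreover have "(A ** Q) $ i $ j = (\<Sum>k\<in>UNIV. if k \<in> B then M i k * Q $ k $ j else 0)"
      using ij by (auto simp: A_def matrix_matrix_mult_def intro!: sum.cong)
    moreover have "(Q ** A) $ i $ j = (\<Sum>k\<in>UNIV. if k \<in> B then Q $ i $ k * M k j else 0)"
      using ij by (auto simp: A_def matrix_matrix_mult_def intro!: sum.cong)
    ultimately show "(\<Sum>k\<in>B. M i k * Q $ k $ j) = (if i = j then 1 else 0)"
      "(\<Sum>k\<in>B. Q $ i $ k * M k j) = (if i = j then 1 else 0)" by (simp_all add: restr)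
  qed
  from someI_ex[OF this] assms(2,3)
  show "(\<Sum>k\<in>B. M i k * inv_on B M k j) = (if i = j then 1 else 0)"
    "(\<Sum>k\<in>B. inv_on B M i k * M k j) = (if i = j then 1 else 0)"
    unfolding inv_on_def by blast+
qed

text \<open>Positive definiteness: the quadratic form of the covariance block at \<open>x\<close> is
  a sum of squares weighted by positive variances, and these squares vanish only for
  \<open>x = 0\<close> because \<open>total_effect \<Lambda>\<close> is injective.\<close>

lemma mom2_injective_on:
  fixes x :: "'v::finite \<Rightarrow> real"
  assumes L: "\<Lambda> \<in> coeff_matrices E" and N: "noise_law N"
    and ker: "\<And>i. i \<in> B \<Longrightarrow> (\<Sum>k\<in>B. mom2 \<Lambda> N i k * x k) = 0" and "k \<in> B"
  shows "x k = 0"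
proof -
  let ?b = "\<lambda>i j. total_effect \<Lambda> $ i $ j"
  define y :: "real^'v" where "y = (\<chi> k. if k \<in> B then x k else 0)"
  have y: "(\<Sum>k\<in>B. ?b l k * x k) = (total_effect \<Lambda> *v y) $ l" for l
    by (simp add: matrix_vector_mult_def y_def if_distrib sum.If_cases cong: if_cong)
  have "0 = (\<Sum>i\<in>B. x i * (\<Sum>k\<in>B. mom2 \<Lambda> N i k * x k))" by (simp add: ker)
  also have "\<dots> = (\<Sum>i\<in>B. \<Sum>k\<in>B. \<Sum>l\<in>UNIV. noise_var N l * ((?b l i * x i) * (?b l k * x k)))"
    by (simp add: mom2_eq[OF N] sum_distrib_left sum_distrib_right mult_ac)
  also have "\<dots> = (\<Sum>i\<in>B. \<Sum>l\<in>UNIV. \<Sum>k\<in>B. noise_var N l * ((?b l i * x i) * (?b l k * x k)))"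
    by (intro sum.cong refl sum.swap)
  also have "\<dots> = (\<Sum>l\<in>UNIV. \<Sum>i\<in>B. \<Sum>k\<in>B. noise_var N l * ((?b l i * x i) * (?b l k * x k)))"
    by (rule sum.swap)
  also have "\<dots> = (\<Sum>l\<in>UNIV. noise_var N l * ((total_effect \<Lambda> *v y) $ l)\<^sup>2)"
    unfolding y[symmetric] by (simp add: power2_eq_square sum_product) (simp add: sum_distrib_left)
  finally have "noise_var N l * ((total_effect \<Lambda> *v y) $ l)\<^sup>2 = 0" for l
    using noise_var_pos[OF N] by (subst (asm) eq_commute, subst (asm) sum_nonneg_eq_0_iff)
      (auto intro!: mult_nonneg_nonneg simp: less_imp_le)
  then have "total_effect \<Lambda> *v y = 0"
    using noise_var_pos[OF N] by (simp add: vec_eq_iff) (metis less_irrefl)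
  then have "y = 0"
    using matrix_inv_mult_cancel(1)[OF coeff_matrices_invertible[OF L], of y] by simp
  then show ?thesis using \<open>k \<in> B\<close> by (simp add: y_def vec_eq_iff) metis
qed

lemma reg_coeff_normal_equations:
  assumes L: "\<Lambda> \<in> coeff_matrices E" and N: "noise_law N" and c: "c \<in> C"
  shows "(\<Sum>b\<in>C. reg_coeff \<Lambda> N C d b * mom2 \<Lambda> N b c) = mom2 \<Lambda> N d c"
proof -
  let ?s = "mom2 \<Lambda> N" and ?Q = "inv_on C (mom2 \<Lambda> N)"
  have inv: "(\<Sum>b\<in>C. ?Q k b * ?s b c) = (if k = c then 1 else 0)" if "k \<in> C" for k
    by (rule inv_on_inverse(2)[OF _ that c]) (rule mom2_injective_on[OF L N])
  have "(\<Sum>b\<in>C. reg_coeff \<Lambda> N C d b * ?s b c) = (\<Sum>b\<in>C. \<Sum>k\<in>C. ?s d k * (?Q k b * ?s b c))"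
    by (simp add: reg_coeff_def sum_distrib_right mult.assoc)
  also have "\<dots> = (\<Sum>k\<in>C. ?s d k * (\<Sum>b\<in>C. ?Q k b * ?s b c))"
    by (subst sum.swap) (simp add: sum_distrib_left)
  also have "\<dots> = (\<Sum>k\<in>C. ?s d k * (if k = c then 1 else 0))"
    by (intro sum.cong refl) (simp only: inv)
  also have "\<dots> = ?s d c" using c by (simp add: if_distrib cong: if_cong)
  finally show ?thesis .
qed

text \<open>Allows regression coefficients to be guessed and then checked, without computing the
  inverse.\<close>

lemma reg_coeff_unique:
  assumes L: "\<Lambda> \<in> coeff_matrices E" and N: "noise_law N"
    and r: "\<And>c. c \<in> C \<Longrightarrow> (\<Sum>b\<in>C. r b * mom2 \<Lambda> N b c) = mom2 \<Lambda> N d c" and "b \<in> C"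
  shows "reg_coeff \<Lambda> N C d b = r b"
proof -
  have "(\<Sum>b\<in>C. mom2 \<Lambda> N c b * (reg_coeff \<Lambda> N C d b - r b)) = 0" if "c \<in> C" for c
    using reg_coeff_normal_equations[OF L N that, of d] r[OF that]
    by (simp add: mom2_commute[of \<Lambda> N c] algebra_simps sum_subtractf)
  then have "reg_coeff \<Lambda> N C d b - r b = 0"
    using mom2_injective_on[OF L N, of C "\<lambda>b. reg_coeff \<Lambda> N C d b - r b"] \<open>b \<in> C\<close> by blast
  then show ?thesis by simp
qed

section \<open>Moments of residuals for ancestral and non-ancestral sets\<close>

lemma residual_moment:
  assumes N: "noise_law N"
  shows "(LINT e|N. (sem \<Lambda> e $ c)\<^sup>2 * residual \<Lambda> N C d e) =
    (\<Sum>i\<in>UNIV. noise_skew N i * ((total_effect \<Lambda> $ i $ c)\<^sup>2 *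
      (total_effect \<Lambda> $ i $ d - (\<Sum>k\<in>C. reg_coeff \<Lambda> N C d k * total_effect \<Lambda> $ i $ k))))"
proof -
  have "residual \<Lambda> N C d e = (\<Sum>i\<in>UNIV. (total_effect \<Lambda> $ i $ d -
      (\<Sum>k\<in>C. reg_coeff \<Lambda> N C d k * total_effect \<Lambda> $ i $ k)) * e $ i)" for e
    unfolding residual_def sem_nth
    by (simp add: algebra_simps sum_subtractf sum_distrib_left sum_distrib_right sum.swap[of _ C UNIV])
  then show ?thesis
    using noise_trilinear[OF N, of "\<lambda>i. total_effect \<Lambda> $ i $ c" "\<lambda>i. total_effect \<Lambda> $ i $ c"]
    by (simp add: sem_nth power2_eq_square)
qed

lemma ancestral_residual_moment:
  assumes C: "ancestral E C" and L: "\<Lambda> \<in> coeff_matrices E" and N: "noise_law N" and c: "c \<in> C"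
  shows "(LINT e|N. (sem \<Lambda> e $ c)\<^sup>2 * residual \<Lambda> N C d e) = 0"
proof -
  let ?b = "\<lambda>i j. total_effect \<Lambda> $ i $ j"
  \<comment> \<open>\<open>w\<close> lists the noise coefficients of the part of \<open>X_d\<close>
    contributed by \<open>C\<close>; \<open>r\<close> expresses this part as a linear combination of
    the \<open>X_k\<close>, and ancestrality confines \<open>r\<close> to \<open>C\<close>.\<close>
  define w :: "real^'a" where "w = (\<chi> i. if i \<in> C then ?b i d else 0)"
  define r where "r = (mat 1 - \<Lambda>) *v w"
  have br: "total_effect \<Lambda> *v r = w"
    unfolding r_def by (rule matrix_inv_mult_cancel[OF coeff_matrices_invertible[OF L]])
  then have "r $ i = 0" if "i \<notin> C" for i
    using total_effect_support_iff[OF L C, of r] that by (simp add: w_def)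
  then have "(\<Sum>k\<in>C. r $ k * ?b i k) = (total_effect \<Lambda> *v r) $ i" for i
    by (simp add: matrix_vector_mult_def mult.commute) (rule sum.mono_neutral_left, auto)
  then have fit: "(\<Sum>k\<in>C. r $ k * ?b i k) = (if i \<in> C then ?b i d else 0)" for i
    by (simp add: br w_def)
  have zero: "?b i k = 0" if "i \<notin> C" "k \<in> C" for i k
    by (rule total_effect_ancestral_eq_0[OF L C that])
  have "(\<Sum>b\<in>C. r $ b * mom2 \<Lambda> N b k) = mom2 \<Lambda> N d k" if k: "k \<in> C" for k
  proof -
    have "(\<Sum>b\<in>C. r $ b * mom2 \<Lambda> N b k)
      = (\<Sum>i\<in>UNIV. noise_var N i * ((\<Sum>b\<in>C. r $ b * ?b i b) * ?b i k))"
      by (simp add: mom2_eq[OF N] sum_distrib_left sum_distrib_right mult_ac sum.swap[of _ C UNIV])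
    also have "\<dots> = mom2 \<Lambda> N d k"
      unfolding mom2_eq[OF N] fit using zero[OF _ k] by (intro sum.cong) auto
    finally show ?thesis .
  qed
  then have r: "reg_coeff \<Lambda> N C d b = r $ b" if "b \<in> C" for b
    by (rule reg_coeff_unique[OF L N _ that])
  \<comment> \<open>The residual contains only noise from outside \<open>C\<close>, whereas
    \<open>X_c\<close> contains only noise from \<open>C\<close>, so every summand vanishes.\<close>
  show ?thesis
    unfolding residual_moment[OF N]
    using zero[OF _ c] by (intro sum.neutral ballI) (simp add: r fit)
qed

lemma nonancestral_residual_moment:
  assumes pc: "(p, c) \<in> E" "p \<notin> C" "c \<in> C"
  shows "\<not> identically E (\<lambda>\<Lambda> N. (LINT e|N. (sem \<Lambda> e $ c)\<^sup>2 * residual \<Lambda> N C p e) = 0)"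
proof -
  have "p \<noteq> c" using pc by blast
  define \<Lambda> :: "real^'a^'a" where "\<Lambda> = (\<chi> i j. of_bool (i = p \<and> j = c))"
  \<comment> \<open>Since \<open>p \<noteq> c\<close>, the square of \<open>\<Lambda>\<close> is
    zero and the Neumann series of the inverse stops after the linear term.\<close>
  define T :: "real^'a^'a" where "T = mat 1 + \<Lambda>"
  have "\<Lambda> ** \<Lambda> = 0" using \<open>p \<noteq> c\<close>
    by (auto simp: \<Lambda>_def matrix_matrix_mult_def vec_eq_iff intro!: sum.neutral)
  then have "\<Lambda> *v (\<Lambda> *v x) = 0" for x by (simp add: matrix_vector_mul_assoc)
  then have inv: "(mat 1 - \<Lambda>) ** T = mat 1" "T ** (mat 1 - \<Lambda>) = mat 1"
    by (simp_all add: T_def matrix_eq matrix_vector_mul_assoc[symmetric]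
        matrix_vector_mult_diff_rdistrib matrix_vector_mult_add_rdistrib
        matrix_vector_right_distrib matrix_vector_mult_diff_distrib)
  then have invertible: "invertible (mat 1 - \<Lambda>)" unfolding invertible_def by blast
  have T: "total_effect \<Lambda> = T"
    using matrix_inv_inverse(2)[OF invertible] inv(1) by (metis matrix_mul_assoc matrix_mul_lid matrix_mul_rid)
  have L: "\<Lambda> \<in> coeff_matrices E" using invertible pc by (auto simp: coeff_matrices_def \<Lambda>_def)
  have t: "T $ i $ j = of_bool (i = j) + of_bool (i = p \<and> j = c)" for i j
    by (simp add: T_def \<Lambda>_def mat_def)
  \<comment> \<open>Skewness at \<open>p\<close> alone reduces the residual moment to the single
    summand for \<open>p\<close>.\<close>
  obtain N :: "(real^'a) measure" where N: "noise_law N" and var: "\<And>i. noise_var N i = 1"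
    and skew: "\<And>i. noise_skew N i = of_bool (i = p)"
    using noise_law_exists[of "\<lambda>_. 1" "\<lambda>i. of_bool (i = p)"] by auto
  let ?r = "reg_coeff \<Lambda> N C p"
  have s: "mom2 \<Lambda> N b c = 2 * of_bool (b = c) + of_bool (b = p)" for b
  proof -
    have "mom2 \<Lambda> N b c = (\<Sum>i\<in>UNIV. of_bool (i = c) * (T $ i $ b) + of_bool (i = p) * (T $ i $ b))"
      unfolding mom2_eq[OF N] T var by (intro sum.cong) (auto simp: t)
    also have "\<dots> = T $ c $ b + T $ p $ b" by (simp add: sum.distrib)
    finally show ?thesis using \<open>p \<noteq> c\<close> by (auto simp: t)
  qed
  \<comment> \<open>The normal equation at \<open>c\<close> suffices: within \<open>C\<close>, only
    \<open>X_c\<close> itself correlates with \<open>X_c\<close>, with variance 2, while its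
    covariance with \<open>X_p\<close> is 1.\<close>
  have "1 = (\<Sum>b\<in>C. ?r b * mom2 \<Lambda> N b c)"
    using reg_coeff_normal_equations[OF L N pc(3), of p] \<open>p \<noteq> c\<close> by (simp add: s)
  also have "\<dots> = (\<Sum>b\<in>C. 2 * ?r c * of_bool (b = c))"
    using pc by (intro sum.cong) (auto simp: s)
  finally have "?r c = 1 / 2" using pc(3) by simp
  have "(\<Sum>k\<in>C. ?r k * T $ p $ k) = (\<Sum>k\<in>C. ?r c * of_bool (k = c))"
    using pc by (intro sum.cong) (auto simp: t)
  also have "\<dots> = 1 / 2" using pc(3) \<open>?r c = 1 / 2\<close> by simp
  finally have "(LINT e|N. (sem \<Lambda> e $ c)\<^sup>2 * residual \<Lambda> N C p e) = 1 / 2"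
    unfolding residual_moment[OF N] T skew using \<open>p \<noteq> c\<close> by (simp add: t)
  then show ?thesis using L N unfolding identically_def by force
qed

section \<open>Admissible pairs\<close>

lemma d2_eq:
  "d2 \<Lambda> N u v = mom2 \<Lambda> N u u * mom3 \<Lambda> N u u v - mom2 \<Lambda> N u v * mom3 \<Lambda> N u u u"
  by (simp add: d2_def det_2 Let_def)

text \<open>As a double sum over a variance index \<open>i\<close> and a skewness index
  \<open>j\<close>, \<open>d2\<close> has summands divisible by
  \<open>b i u * b j u * (b i u * b j v - b i v * b j u)\<close>, so this product is nonzero for
  some pair.\<close>

lemma d2_nonzero_sources:
  assumes N: "noise_law N" and d2: "d2 \<Lambda> N u v \<noteq> 0"
  defines "b \<equiv> \<lambda>i j. total_effect \<Lambda> $ i $ j"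
  obtains i j where "b i u \<noteq> 0" "b j u \<noteq> 0" "b i u * b j v \<noteq> b i v * b j u"
proof -
  have "\<exists>i j. b i u \<noteq> 0 \<and> b j u \<noteq> 0 \<and> b i u * b j v \<noteq> b i v * b j u"
  proof (rule ccontr)
    assume "\<not> ?thesis"
    then have zero: "b i u * b j u * (b i u * b j v - b i v * b j u) = 0" for i j by auto
    have "d2 \<Lambda> N u v = (\<Sum>i\<in>UNIV. \<Sum>j\<in>UNIV. noise_var N i * noise_skew N j * b j u *
        (b i u * b j u * (b i u * b j v - b i v * b j u)))"
      unfolding d2_eq mom2_eq[OF N] mom3_eq[OF N] sum_product sum_subtractf[symmetric]
      by (intro sum.cong refl) (simp add: b_def algebra_simps)
    then show False using d2 by (simp only: zero) simp
  qed
  then show ?thesis using that by blast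
qed

text \<open>
  With third moments concentrated on \<open>i\<close> and \<open>j\<close>, \<^const>\<open>d3\<close> is affine in the variance of the
  \<open>k\<close>-th noise component, with slope
  \<open>\<plusminus>(b\<^sub>i\<^sub>u b\<^sub>j\<^sub>v - b\<^sub>i\<^sub>v b\<^sub>j\<^sub>u)\<^sup>2 (b\<^sub>k\<^sub>u b\<^sub>i\<^sub>v - b\<^sub>k\<^sub>v b\<^sub>i\<^sub>u) (b\<^sub>k\<^sub>u b\<^sub>j\<^sub>v - b\<^sub>k\<^sub>v b\<^sub>j\<^sub>u)\<close>.
\<close>

lemma d3_nonzero:
  fixes \<Lambda> :: "real^'v::finite^'v"
  defines "b \<equiv> \<lambda>i j. total_effect \<Lambda> $ i $ j"
  assumes ij: "b i u * b j v \<noteq> b i v * b j u"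
    and ik: "b i u * b k v \<noteq> b i v * b k u" and jk: "b j u * b k v \<noteq> b j v * b k u"
  obtains N where "noise_law N" "d3 \<Lambda> N u v \<noteq> 0"
proof -
  \<comment> \<open>Two laws differing only in the variance at \<open>k\<close>, which is 1 or 2:
    the difference of their \<open>d3\<close> values is exactly the slope, so \<open>d3\<close>
    cannot vanish for both.\<close>
  define w :: "'v \<Rightarrow> real" where "w l = 1 + of_bool (l = k)" for l
  define q :: "'v \<Rightarrow> real" where "q l = of_bool (l = i) + of_bool (l = j)" for l
  obtain N1 :: "(real^'v) measure" where N1: "noise_law N1"
    "\<And>l. noise_var N1 l = 1" "\<And>l. noise_skew N1 l = q l"
    using noise_law_exists[of "\<lambda>_. 1" q] by auto
  obtain N2 :: "(real^'v) measure" where N2: "noise_law N2"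
    "\<And>l. noise_var N2 l = w l" "\<And>l. noise_skew N2 l = q l"
    by (rule noise_law_exists[of w q]) (auto simp: w_def)
  have mom2: "mom2 \<Lambda> N2 x y = mom2 \<Lambda> N1 x y + b k x * b k y" for x y
    unfolding mom2_eq[OF N1(1)] mom2_eq[OF N2(1)] N1 N2
    by (simp add: b_def w_def distrib_right sum.distrib)
  have mom3: "mom3 \<Lambda> N1 x y z = b i x * b i y * b i z + b j x * b j y * b j z"
    "mom3 \<Lambda> N2 x y z = b i x * b i y * b i z + b j x * b j y * b j z" for x y z
    unfolding mom3_eq[OF N1(1)] mom3_eq[OF N2(1)] N1 N2
    by (simp_all add: b_def q_def distrib_right sum.distrib)
  have "d3 \<Lambda> N2 u v - d3 \<Lambda> N1 u v = (b i u * b j v - b i v * b j u)\<^sup>2 *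
      (b i u * b k v - b i v * b k u) * (b j u * b k v - b j v * b k u)"
    by (simp add: d3_def det_3 Let_def mom2 mom3) (simp add: algebra_simps power2_eq_square)
  also have "\<dots> \<noteq> 0" using ij ik jk by simp
  finally have "d3 \<Lambda> N1 u v \<noteq> 0 \<or> d3 \<Lambda> N2 u v \<noteq> 0" by auto
  then show ?thesis using that N1(1) N2(1) by blast
qed

lemma admissible_pair_reaches:
  assumes d3: "identically E (\<lambda>\<Lambda> N. d3 \<Lambda> N u v = 0)"
    and d2: "\<not> identically E (\<lambda>\<Lambda> N. d2 \<Lambda> N u v = 0)"
  shows "(v, u) \<in> E\<^sup>*"
proof (rule ccontr)
  assume "(v, u) \<notin> E\<^sup>*"
  then have v: "v \<notin> anc E {u}" and u: "u \<in> anc E {u}" by (auto simp: anc_def)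
  obtain \<Lambda> N where L: "\<Lambda> \<in> coeff_matrices E" and N: "noise_law N" "d2 \<Lambda> N u v \<noteq> 0"
    using d2 unfolding identically_def by blast
  let ?b = "\<lambda>i j. total_effect \<Lambda> $ i $ j"
  obtain i j where ij: "?b i u \<noteq> 0" "?b j u \<noteq> 0" "?b i u * ?b j v \<noteq> ?b i v * ?b j u"
    by (rule d2_nonzero_sources[OF N])
  obtain k where k: "k \<notin> anc E {u}" "?b k v \<noteq> 0"
    by (rule total_effect_outside_ancestral[OF L ancestral_anc v])
  \<comment> \<open>Row \<open>k\<close> is zero at \<open>u\<close> and nonzero at
    \<open>v\<close>, hence not proportional to rows \<open>i\<close> and \<open>j\<close>, which
    are nonzero at \<open>u\<close>. The same \<open>\<Lambda>\<close> is kept; only the noise law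
    changes.\<close>
  have "?b k u = 0" by (rule total_effect_ancestral_eq_0[OF L ancestral_anc k(1) u])
  then obtain N' where "noise_law N'" "d3 \<Lambda> N' u v \<noteq> 0"
    using d3_nonzero[of \<Lambda> i u j v k] ij k(2) by auto
  then show False using d3 L unfolding identically_def by blast
qed

theorem lemma4p8:
  fixes E :: "('v::finite \<times> 'v) set" and C :: "'v set"
  assumes "cycle_disjoint E"
    and "C \<in> max_admissible E"
  shows "root_cycle E C \<longleftrightarrow>
    (\<forall>D \<in> max_admissible E - {C}.
       identically E (\<lambda>\<Lambda> N. \<forall>c \<in> C. \<forall>d \<in> D.
         (LINT e|N. (sem \<Lambda> e $ c)\<^sup>2 * residual \<Lambda> N C d e) = 0))"
proof
  assume "root_cycle E C"
  then have "ancestral E C" by (simp add: root_cycle_def)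
  then show "\<forall>D \<in> max_admissible E - {C}. identically E (\<lambda>\<Lambda> N. \<forall>c \<in> C. \<forall>d \<in> D.
      (LINT e|N. (sem \<Lambda> e $ c)\<^sup>2 * residual \<Lambda> N C d e) = 0)"
    unfolding identically_def by (blast intro: ancestral_residual_moment)
next
  assume zero: "\<forall>D \<in> max_admissible E - {C}. identically E (\<lambda>\<Lambda> N. \<forall>c \<in> C. \<forall>d \<in> D.
      (LINT e|N. (sem \<Lambda> e $ c)\<^sup>2 * residual \<Lambda> N C d e) = 0)"
  have adm: "admissible E C" and max: "\<And>C'. admissible E C' \<Longrightarrow> C \<subseteq> C' \<Longrightarrow> C' = C"
    using assms(2) by (auto simp: max_admissible_def)
  have "ancestral E C"
  proof (rule ancestralI, rule ccontr)
    fix p c assume pc: "(p, c) \<in> E" "c \<in> C" "p \<notin> C"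
    \<comment> \<open>Any maximal set through \<open>p\<close> differs from \<open>C\<close> because
      \<open>p \<notin> C\<close>, so the hypothesis applies to it.\<close>
    obtain D where "{p} \<subseteq> D" "D \<in> max_admissible E"
      using max_admissible_extend[OF admissible_singleton] .
    with pc(3) have "p \<in> D" "D \<in> max_admissible E - {C}" by auto
    with zero pc(2) have "identically E (\<lambda>\<Lambda> N. (LINT e|N. (sem \<Lambda> e $ c)\<^sup>2 * residual \<Lambda> N C p e) = 0)"
      unfolding identically_def by blast
    then show False using nonancestral_residual_moment[OF pc(1,3,2)] by blast
  qed
  \<comment> \<open>The empty set is properly contained in an admissible singleton and so is not
    maximal.\<close>
  moreover have "C \<noteq> {}" using max[OF admissible_singleton] by blast
  moreover have "(u, v) \<in> E\<^sup>*" if "u \<in> C" "v \<in> C" for u v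
    using adm that admissible_pair_reaches[of E v u] by (cases "u = v") (auto simp: admissible_def)
  ultimately show "root_cycle E C" by (intro root_cycleI[OF assms(1)])
qed

end
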